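(* Consider the $T$-period setting described in the context. Assume: (Irreversible treatment) For all $t\in\mathcal{T}\setminus\{T\}$, $D_{i,t}=1\implies D_{i,t+1}=1$. (Exclusion) For each $t\in\mathcal{T}$ and $z\in\{0,1\}$, $Y_{i,t}(0,z)=Y_{i,t}(0)$ and $Y_{i,t}(1,\tau,z)=Y_{i,t}(1,\tau)$ for all $\tau\in\{0,\dots,t-1\}$ (that is, potential outcomes do not depend on $z$). (Independence) For all $t\in\mathcal{T}$, $\big(Y_{i,t}(0),Y_{i,t}(1,0),\dots,Y_{i,t}(1,t-1),D_{i,1}(1),D_{i,1}(0),\dots,D_{i,t}(1),D_{i,t}(0)\big)$ is independent of $Z_i$. (Relevance at $t=1$) $FS_1\neq 0$. (Monotonicity at $t=1$) $\mathbb{P}(F_1)=0$. Then, for each $t\in\mathcal{T}\setminus\{1\}$, $$RF_t=\mathbb{P}(C_1)\Delta_t^{t-1}(C_1)-\sum_{k=2}^{t}\sum_{g\in\mathcal{G}^-_k}\mathbb{P}(g)\Delta_t^{t-k}(g)+\sum_{k=2}^{t}\sum_{g\in\mathcal{G}^+_k}\mathbb{P}(g)\Delta_t^{t-k}(g)$$ and $$FS_t=\mathbb{P}(C_1)-\sum_{k=2}^{t}\sum_{g\in\mathcal{G}^-_k}\mathbb{P}(g)+\sum_{k=2}^{t}\sum_{g\in\mathcal{G}^+_k}\mathbb{P}(g).$$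
   Context: Setting. Time is $t\in\mathcal{T}=\{1,\dots,T\}$; $i$ denotes a generic observation. $Z_i\in\{0,1\}$ is a time-invariant binary instrument with $0<\mathbb{P}(Z_i=1)<1$. $D_{i,t}(z)\in\{0,1\}$ is the potential treatment status at $t$ under instrument value $z$, and the observed status is $D_{i,t}=D_{i,t}(Z_i)$. No unit is treated before period 1. $Y_{i,t}(0,z)$ is the potential outcome at $t$ if $i$ has not been treated up to $t$ and the instrument is $z$; $Y_{i,t}(1,\tau,z)$, $\tau\in\{0,\dots,t-1\}$, is the potential outcome at $t$ if $i$ is first treated at period $t-\tau$ and the instrument is $z$. The observed outcome $Y_{i,t}$ equals $Y_{i,t}(0,Z_i)$ if $i$ has not been treated up to $t$, and $Y_{i,t}(1,t-s,Z_i)$ if $i$ was first treated at $s\le t$. All expectations written are assumed to exist (one may take all potential outcomes to be integrable). Latent types at $t$ (events): $AT_t=\{D_{i,t}(1)=D_{i,t}(0)=1\}$, $C_t=\{D_{i,t}(1)>D_{i,t}(0)\}$, $F_t=\{D_{i,t}(1)<D_{i,t}(0)\}$, $NT_t=\{D_{i,t}(1)=D_{i,t}(0)=0\}$. $C_{t:t'}$ means complier in every period from $t$ to $t'$ ($\bigcap_{s=t}^{t'}C_s$), similarly $F_{t:t'}$, $NT_{t:t'}$; a tuple denotes the intersection of its entries. Sets of latent groups: $\mathcal{G}^+_2=\{(NT_1,C_2)\}$, $\mathcal{G}^-_2=\{(C_1,AT_2),(NT_1,F_2)\}$, and for $t\in\mathcal{T}\setminus\{1,2\}$, $$\mathcal{G}^+_t=\{(NT_{1:t-1},C_t),\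 (NT_{1:\ell-1},F_{\ell:t-1},AT_t):\ell=2,\dots,t-1\},$$ $$\mathcal{G}^-_t=\{(C_{1:t-1},AT_t),\ (NT_{1:t-1},F_t),\ (NT_{1:\ell-1},C_{\ell:t-1},AT_t):\ell=2,\dots,t-1\}.$$ Estimands: $RF_t=\mathbb{E}[Y_{i,t}\mid Z_i=1]-\mathbb{E}[Y_{i,t}\mid Z_i=0]$ and $FS_t=\mathbb{E}[D_{i,t}\mid Z_i=1]-\mathbb{E}[D_{i,t}\mid Z_i=0]$. Causal effects (under exclusion): for a latent group $g$, $\Delta_t^\tau(g)=\mathbb{E}[Y_{i,t}(1,\tau)-Y_{i,t}(0)\mid g]$. A product $\mathbb{P}(g)\Delta_t^\tau(g)$ with $\mathbb{P}(g)=0$ is read as $0$. *)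

theory Defs
  imports "HOL-Probability.Probability"
begin

text \<open>
  Binary quantities are Booleans: the instrument \<open>Z\<close>, its values \<open>z\<close> and the potential
  treatment status \<open>D t z \<omega>\<close> identify 1 with \<open>True\<close> and 0 with \<open>False\<close>.
  Periods are natural numbers starting at 1.  A potential outcome that may depend on the instrument
  is written \<open>Y0z t z \<omega>\<close> (untreated up to \<open>t\<close>) and \<open>Y1z t \<tau> z \<omega>\<close> (first treated at
  \<open>t - \<tau>\<close>); after exclusion it is \<open>Y0 t \<omega>\<close> and \<open>Y1 t \<tau> \<omega>\<close>.
\<close>

text \<open>Elementary conditional expectation given an event; it is 0 if the event has probability 0.\<close>

definition expectation_given :: "'a measure \<Rightarrow> ('a \<Rightarrow> real) \<Rightarrow> 'a set \<Rightarrow> real" where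
  "expectation_given M X A = (LINT \<omega>:A|M. X \<omega>) / measure M A"

definition observed_D ::
  "('a \<Rightarrow> bool) \<Rightarrow> (nat \<Rightarrow> bool \<Rightarrow> 'a \<Rightarrow> bool) \<Rightarrow> nat \<Rightarrow> 'a \<Rightarrow> bool" where
  "observed_D Z D t \<omega> = D t (Z \<omega>) \<omega>"

text \<open>No unit is treated before period 1, so the search for the first treated period starts there.\<close>

definition first_treated ::
  "('a \<Rightarrow> bool) \<Rightarrow> (nat \<Rightarrow> bool \<Rightarrow> 'a \<Rightarrow> bool) \<Rightarrow> 'a \<Rightarrow> nat" where
  "first_treated Z D \<omega> = (LEAST s. 1 \<le> s \<and> observed_D Z D s \<omega>)"

definition observed_Y ::
  "('a \<Rightarrow> bool) \<Rightarrow> (nat \<Rightarrow> bool \<Rightarrow> 'a \<Rightarrow> bool) \<Rightarrow> (nat \<Rightarrow> bool \<Rightarrow> 'a \<Rightarrow> real) \<Rightarrow>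
    (nat \<Rightarrow> nat \<Rightarrow> bool \<Rightarrow> 'a \<Rightarrow> real) \<Rightarrow> nat \<Rightarrow> 'a \<Rightarrow> real" where
  "observed_Y Z D Y0z Y1z t \<omega> =
    (if \<exists>s\<in>{1..t}. observed_D Z D s \<omega>
     then Y1z t (t - first_treated Z D \<omega>) (Z \<omega>) \<omega>
     else Y0z t (Z \<omega>) \<omega>)"

definition RF ::
  "'a measure \<Rightarrow> ('a \<Rightarrow> bool) \<Rightarrow> (nat \<Rightarrow> bool \<Rightarrow> 'a \<Rightarrow> bool) \<Rightarrow> (nat \<Rightarrow> bool \<Rightarrow> 'a \<Rightarrow> real) \<Rightarrow>
    (nat \<Rightarrow> nat \<Rightarrow> bool \<Rightarrow> 'a \<Rightarrow> real) \<Rightarrow> nat \<Rightarrow> real" where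
  "RF M Z D Y0z Y1z t =
    expectation_given M (observed_Y Z D Y0z Y1z t) {\<omega> \<in> space M. Z \<omega>} -
    expectation_given M (observed_Y Z D Y0z Y1z t) {\<omega> \<in> space M. \<not> Z \<omega>}"

definition FS ::
  "'a measure \<Rightarrow> ('a \<Rightarrow> bool) \<Rightarrow> (nat \<Rightarrow> bool \<Rightarrow> 'a \<Rightarrow> bool) \<Rightarrow> nat \<Rightarrow> real" where
  "FS M Z D t =
    expectation_given M (\<lambda>\<omega>. of_bool (observed_D Z D t \<omega>)) {\<omega> \<in> space M. Z \<omega>} -
    expectation_given M (\<lambda>\<omega>. of_bool (observed_D Z D t \<omega>)) {\<omega> \<in> space M. \<not> Z \<omega>}"

datatype latent_type = AT | C | F | NT

primrec has_type ::
  "(nat \<Rightarrow> bool \<Rightarrow> 'a \<Rightarrow> bool) \<Rightarrow> latent_type \<Rightarrow> nat \<Rightarrow> 'a \<Rightarrow> bool" where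
  "has_type D AT t \<omega> \<longleftrightarrow> D t True \<omega> \<and> D t False \<omega>"
| "has_type D C t \<omega> \<longleftrightarrow> D t True \<omega> > D t False \<omega>"
| "has_type D F t \<omega> \<longleftrightarrow> D t True \<omega> < D t False \<omega>"
| "has_type D NT t \<omega> \<longleftrightarrow> \<not> D t True \<omega> \<and> \<not> D t False \<omega>"

text \<open>
  A latent group is a tuple of entries: \<open>(a, s, s')\<close> means being of type \<open>a\<close> in every
  period from \<open>s\<close> to \<open>s'\<close>.  Groups are kept as such labels rather than as events, so that
  sums over a set of groups do not identify groups whose events happen to coincide.
\<close>

type_synonym latent_group = "(latent_type \<times> nat \<times> nat) list"

definition group_event ::
  "'a measure \<Rightarrow> (nat \<Rightarrow> bool \<Rightarrow> 'a \<Rightarrow> bool) \<Rightarrow> latent_group \<Rightarrow> 'a set" where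
  "group_event M D g =
    {\<omega> \<in> space M. \<forall>(a, s, s') \<in> set g. \<forall>r\<in>{s..s'}. has_type D a r \<omega>}"

definition group_prob ::
  "'a measure \<Rightarrow> (nat \<Rightarrow> bool \<Rightarrow> 'a \<Rightarrow> bool) \<Rightarrow> latent_group \<Rightarrow> real" where
  "group_prob M D g = measure M (group_event M D g)"

text \<open>For \<open>t = 2\<close> the index set of \<open>l\<close> is empty and only the separately listed groups remain.\<close>

definition groups_plus :: "nat \<Rightarrow> latent_group set" where
  "groups_plus t =
    {[(NT, 1, t - 1), (C, t, t)]} \<union>
    {[(NT, 1, l - 1), (F, l, t - 1), (AT, t, t)] | l. l \<in> {2..t - 1}}"

definition groups_minus :: "nat \<Rightarrow> latent_group set" where
  "groups_minus t =
    {[(C, 1, t - 1), (AT, t, t)], [(NT, 1, t - 1), (F, t, t)]} \<union>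
    {[(NT, 1, l - 1), (C, l, t - 1), (AT, t, t)] | l. l \<in> {2..t - 1}}"

definition causal_effect ::
  "'a measure \<Rightarrow> (nat \<Rightarrow> bool \<Rightarrow> 'a \<Rightarrow> bool) \<Rightarrow> (nat \<Rightarrow> 'a \<Rightarrow> real) \<Rightarrow>
    (nat \<Rightarrow> nat \<Rightarrow> 'a \<Rightarrow> real) \<Rightarrow> nat \<Rightarrow> nat \<Rightarrow> latent_group \<Rightarrow> real" where
  "causal_effect M D Y0 Y1 t \<tau> g =
    expectation_given M (\<lambda>\<omega>. Y1 t \<tau> \<omega> - Y0 t \<omega>) (group_event M D g)"

definition irreversible_treatment ::
  "'a measure \<Rightarrow> nat \<Rightarrow> ('a \<Rightarrow> bool) \<Rightarrow> (nat \<Rightarrow> bool \<Rightarrow> 'a \<Rightarrow> bool) \<Rightarrow> bool" where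
  "irreversible_treatment M T Z D \<longleftrightarrow>
    (\<forall>t\<in>{1..T} - {T}. AE \<omega> in M. observed_D Z D t \<omega> \<longrightarrow> observed_D Z D (t + 1) \<omega>)"

definition exclusion ::
  "'a measure \<Rightarrow> nat \<Rightarrow> (nat \<Rightarrow> bool \<Rightarrow> 'a \<Rightarrow> real) \<Rightarrow> (nat \<Rightarrow> nat \<Rightarrow> bool \<Rightarrow> 'a \<Rightarrow> real) \<Rightarrow>
    (nat \<Rightarrow> 'a \<Rightarrow> real) \<Rightarrow> (nat \<Rightarrow> nat \<Rightarrow> 'a \<Rightarrow> real) \<Rightarrow> bool" where
  "exclusion M T Y0z Y1z Y0 Y1 \<longleftrightarrow>
    (\<forall>t\<in>{1..T}. \<forall>z.
      (AE \<omega> in M. Y0z t z \<omega> = Y0 t \<omega>) \<and>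
      (\<forall>\<tau>\<in>{0..t - 1}. AE \<omega> in M. Y1z t \<tau> z \<omega> = Y1 t \<tau> \<omega>))"

text \<open>
  \<open>indep_var\<close> forces both random variables to have the same value type, so independence of
  the vector and \<open>Z\<close> is stated as independence of the \<open>\<sigma>\<close>-algebras they generate.
\<close>

definition independence ::
  "'a measure \<Rightarrow> nat \<Rightarrow> ('a \<Rightarrow> bool) \<Rightarrow> (nat \<Rightarrow> bool \<Rightarrow> 'a \<Rightarrow> bool) \<Rightarrow>
    (nat \<Rightarrow> 'a \<Rightarrow> real) \<Rightarrow> (nat \<Rightarrow> nat \<Rightarrow> 'a \<Rightarrow> real) \<Rightarrow> bool" where
  "independence M T Z D Y0 Y1 \<longleftrightarrow>
    (\<forall>t\<in>{1..T}.
      prob_space.indep_set M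
        (sets (vimage_algebra (space M)
          (\<lambda>\<omega>. (Y0 t \<omega>,
                 \<lambda>\<tau>\<in>{0..t - 1}. Y1 t \<tau> \<omega>,
                 \<lambda>(s, z)\<in>{1..t} \<times> UNIV. D s z \<omega>))
          (borel \<Otimes>\<^sub>M (\<Pi>\<^sub>M \<tau>\<in>{0..t - 1}. borel) \<Otimes>\<^sub>M
           (\<Pi>\<^sub>M (s, z)\<in>{1..t} \<times> UNIV. count_space UNIV))))
        (sets (vimage_algebra (space M) Z (count_space UNIV))))"

end

theory Submission
  imports Defs
begin

text \<open>
  By independence, irreversibility of the observed treatment passes to the potential treatment
  paths almost surely, and \<open>RF\<^sub>t\<close> is the expectation of the outcome under the path
  \<open>D(1)\<close> minus that under \<open>D(0)\<close>.  Each of these outcomes equals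
  \<open>Y\<^sub>t(0)\<close> plus the effect \<open>Y\<^sub>t(1, t - k) - Y\<^sub>t(0)\<close> at the onset
  \<open>k\<close> of its path.  Classifying onset at \<open>k\<close> under one path according to the onset under
  the other turns the difference of the onset indicators into the signed sum of the indicators of the
  latent groups; onsets that agree cancel, and \<open>F\<^sub>1\<close> is null.  The first stage is the
  same computation with unit effects.
\<close>

section \<open>Onset of a single treatment path\<close>

text \<open>The range starts at 1, as in \<open>first_treated\<close>: the value \<open>d 0\<close>
  is ignored and onset at 1 is just \<open>d 1\<close>.\<close>

definition onset :: "(nat \<Rightarrow> bool) \<Rightarrow> nat \<Rightarrow> bool" where
  "onset d k \<longleftrightarrow> d k \<and> (\<forall>s\<in>{1..<k}. \<not> d s)"

lemma Least_onset:
  assumes "1 \<le> k" "onset d k"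
  shows "(LEAST s. 1 \<le> s \<and> d s) = k"
  using assms unfolding onset_def
  by (intro Least_equality) (auto simp: not_le[symmetric])

lemma onset_Least:
  assumes "s \<in> {1..t}" "d s"
  defines "k \<equiv> LEAST s. 1 \<le> s \<and> d s"
  shows "k \<in> {1..t}" "onset d k"
proof -
  have k: "1 \<le> k \<and> d k" unfolding k_def by (rule LeastI[of _ s]) (use assms in auto)
  moreover have "k \<le> s" unfolding k_def by (rule Least_le) (use assms in auto)
  ultimately show "k \<in> {1..t}" using assms by auto
  have "\<not> d r" if "r \<in> {1..<k}" for r
    using not_less_Least[of r "\<lambda>s. 1 \<le> s \<and> d s"] that unfolding k_def by auto
  then show "onset d k" using k by (auto simp: onset_def)
qed

text \<open>An onset is unique if it exists, so the sum selects the value of \<open>f\<close> there.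
  This turns the case distinction and the \<open>LEAST\<close> in \<open>observed_Y\<close> into an
  expression linear in onset indicators.\<close>

lemma sum_onset:
  fixes f :: "nat \<Rightarrow> real"
  shows "(\<Sum>k=1..t. of_bool (onset d k) * f k) =
    (if \<exists>s\<in>{1..t}. d s then f (LEAST s. 1 \<le> s \<and> d s) else 0)"
proof (cases "\<exists>s\<in>{1..t}. d s")
  case True
  then obtain s where s: "s \<in> {1..t}" "d s" by blast
  define m where "m = (LEAST s. 1 \<le> s \<and> d s)"
  have m: "m \<in> {1..t}" "onset d m" using onset_Least[of s t d, OF s] by (auto simp: m_def)
  have "(\<Sum>k=1..t. of_bool (onset d k) * f k) = (\<Sum>k=1..t. if k = m then f k else 0)"
    using m Least_onset[of _ d] by (intro sum.cong) (auto simp: m_def)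
  then show ?thesis using True m by (simp add: m_def)
next
  case False
  then have "(\<Sum>k=1..t. of_bool (onset d k) * f k) = 0"
    by (intro sum.neutral) (auto simp: onset_def)
  with False show ?thesis by auto
qed

lemma irreversible_path_mono:
  fixes d :: "nat \<Rightarrow> bool"
  assumes "\<And>s. s \<in> {1..<t} \<Longrightarrow> d s \<Longrightarrow> d (Suc s)" and "1 \<le> r" "r \<le> s" "s \<le> t" "d r"
  shows "d s"
  using \<open>r \<le> s\<close> \<open>s \<le> t\<close>
proof (induction s rule: dec_induct)
  case (step n)
  then show ?case using assms by auto
qed (rule \<open>d r\<close>)

text \<open>With unit weights the sum records whether treatment has begun by \<open>t\<close>;
  irreversibility makes this the same as being treated at \<open>t\<close>. The first stage rests on
  it.\<close>

lemma sum_onset_irreversible: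
  assumes "\<And>s. s \<in> {1..<t} \<Longrightarrow> d s \<Longrightarrow> d (Suc s)" and "1 \<le> t"
  shows "(\<Sum>k=1..t. of_bool (onset d k)) = (of_bool (d t) :: real)"
proof -
  have "(\<exists>s\<in>{1..t}. d s) \<longleftrightarrow> d t"
    using irreversible_path_mono[of t d _ t] assms by auto
  then show ?thesis
    using sum_onset[of d "\<lambda>_. 1" t] by simp
qed

text \<open>When \<open>a\<close> starts at \<open>k\<close>, the path \<open>b\<close> is untreated
  through \<open>k\<close>, starts at \<open>k\<close>, starts at 1, or starts strictly in between;
  \<open>2 \<le> k\<close> keeps these cases disjoint. The second case is symmetric in
  \<open>a\<close> and \<open>b\<close> and will cancel; the others are matched with latent
  groups.\<close>

lemma onset_split:
  fixes a b :: "nat \<Rightarrow> bool"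
  assumes "2 \<le> k"
  shows "(of_bool (onset a k) :: real) =
    of_bool (onset a k \<and> (\<forall>s\<in>{1..k}. \<not> b s)) + of_bool (onset a k \<and> onset b k) +
    of_bool (onset a k \<and> b 1) + (\<Sum>l=2..k-1. of_bool (onset a k \<and> onset b l))"
proof -
  have *: "{1..k} = insert 1 (insert k {2..k-1})" using assms by auto
  \<comment> \<open>The onset indicators of \<open>b\<close> add up to 0 or 1. Splitting off
    \<open>l = 1\<close> and \<open>l = k\<close> leaves the onsets strictly in between.\<close>
  have "(\<Sum>l=1..k. of_bool (onset b l)) = (of_bool (\<exists>s\<in>{1..k}. b s) :: real)"
    using sum_onset[of b "\<lambda>_. 1" k] by simp
  moreover have "(\<Sum>l=1..k. of_bool (onset b l)) =
      (of_bool (b 1) + (of_bool (onset b k) + (\<Sum>l=2..k-1. of_bool (onset b l))) :: real)"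
    unfolding * using assms by (subst sum.insert; auto simp: onset_def)+
  moreover have "(of_bool (\<forall>s\<in>{1..k}. \<not> b s) :: real) = 1 - of_bool (\<exists>s\<in>{1..k}. b s)"
    by auto
  ultimately show ?thesis
    by (cases "onset a k") (simp_all del: sum_of_bool_eq)
qed

section \<open>Latent groups as pairs of onsets\<close>

text \<open>The labels are pairwise different lists, by their length or by \<open>l\<close>, so each
  group contributes exactly one summand even where events coincide.\<close>

lemma sum_groups_plus:
  fixes h :: "latent_group \<Rightarrow> real"
  shows "sum h (groups_plus k) =
    h [(NT, 1, k-1), (C, k, k)] + (\<Sum>l=2..k-1. h [(NT, 1, l-1), (F, l, k-1), (AT, k, k)])"
proof -
  have *: "groups_plus k = insert [(NT, 1, k-1), (C, k, k)]
      ((\<lambda>l. [(NT, 1, l-1), (F, l, k-1), (AT, k, k)]) ` {2..k-1})"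
    by (auto simp: groups_plus_def)
  show ?thesis unfolding *
    by (subst sum.insert) (auto simp: sum.reindex inj_on_def)
qed

lemma sum_groups_minus:
  fixes h :: "latent_group \<Rightarrow> real"
  shows "sum h (groups_minus k) =
    h [(C, 1, k-1), (AT, k, k)] + h [(NT, 1, k-1), (F, k, k)] +
    (\<Sum>l=2..k-1. h [(NT, 1, l-1), (C, l, k-1), (AT, k, k)])"
proof -
  have *: "groups_minus k = insert [(C, 1, k-1), (AT, k, k)] (insert [(NT, 1, k-1), (F, k, k)]
      ((\<lambda>l. [(NT, 1, l-1), (C, l, k-1), (AT, k, k)]) ` {2..k-1}))"
    by (auto simp: groups_minus_def)
  show ?thesis unfolding *
    by (simp add: image_iff) (auto simp: sum.reindex inj_on_def)
qed

text \<open>Irreversibility keeps \<open>b\<close> treated from \<open>l\<close> on, so up to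
  \<open>k - 1\<close> only \<open>b\<close> is treated, and at \<open>k\<close> both are. For
  \<open>a\<close>, \<open>b\<close> the paths under \<open>True\<close> and \<open>False\<close>
  the middle stretch has type \<open>F\<close>; with the roles exchanged it has type
  \<open>C\<close>. For \<open>l = 1\<close> the initial \<open>NT\<close> stretch is empty.\<close>

lemma onset_pair_iff:
  fixes a b :: "nat \<Rightarrow> bool"
  assumes "\<And>s. s \<in> {1..<k} \<Longrightarrow> a s \<Longrightarrow> a (Suc s)" "\<And>s. s \<in> {1..<k} \<Longrightarrow> b s \<Longrightarrow> b (Suc s)"
    and "1 \<le> l" "l < k"
  shows "onset a k \<and> onset b l \<longleftrightarrow>
    (\<forall>r\<in>{1..l-1}. \<not> a r \<and> \<not> b r) \<and> (\<forall>r\<in>{l..k-1}. \<not> a r \<and> b r) \<and> a k \<and> b k"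
    (is "?L \<longleftrightarrow> ?R")
proof
  assume L: ?L
  then have "b r" if "r \<in> {l..k}" for r
    using irreversible_path_mono[of k b l r] assms that by (auto simp: onset_def)
  then show ?R using L assms by (auto simp: onset_def)
next
  assume R: ?R
  have "\<not> a s" if "s \<in> {1..<k}" for s
    using R that by (cases "s < l") auto
  moreover have "b l" using R assms by auto
  ultimately show ?L using R by (auto simp: onset_def)
qed

text \<open>Apply \<open>onset_split\<close> in both directions and subtract. Simultaneous onsets
  cancel, the remaining onsets under \<open>True\<close> give \<open>groups_plus\<close>, and those
  under \<open>False\<close> give \<open>groups_minus\<close>.\<close>

lemma onset_diff_eq_groups:
  assumes "2 \<le> k" "\<omega> \<in> space M"
    and irr: "\<And>s z. s \<in> {1..<k} \<Longrightarrow> D s z \<omega> \<Longrightarrow> D (Suc s) z \<omega>"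
    and F1: "\<not> has_type D F 1 \<omega>"
  shows "(of_bool (onset (\<lambda>s. D s True \<omega>) k) :: real) - of_bool (onset (\<lambda>s. D s False \<omega>) k) =
    (\<Sum>g\<in>groups_plus k. indicator (group_event M D g) \<omega>) -
    (\<Sum>g\<in>groups_minus k. indicator (group_event M D g) \<omega>)"
proof -
  define a b where "a = (\<lambda>s. D s True \<omega>)" and "b = (\<lambda>s. D s False \<omega>)"
  note ab = onset_pair_iff[of k a b] and ba = onset_pair_iff[of k b a]
  have irr': "a (Suc s)" if "s \<in> {1..<k}" "a s" for s using irr that by (auto simp: a_def)
  have irr'': "b (Suc s)" if "s \<in> {1..<k}" "b s" for s using irr that by (auto simp: b_def)
  note ab = ab[OF irr' irr''] and ba = ba[OF irr'' irr']
  have split: "{1..k} = insert k {1..k-1}" "{1..<k} = {1..k-1}"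
    using assms(1) by auto
  have C: "indicator (group_event M D [(NT, 1, k-1), (C, k, k)]) \<omega> =
      (of_bool (onset a k \<and> (\<forall>s\<in>{1..k}. \<not> b s)) :: real)"
    unfolding group_event_def indicator_def onset_def split using assms(2)
    by (auto simp: a_def b_def)
  have F: "indicator (group_event M D [(NT, 1, k-1), (F, k, k)]) \<omega> =
      (of_bool (onset b k \<and> (\<forall>s\<in>{1..k}. \<not> a s)) :: real)"
    unfolding group_event_def indicator_def onset_def split using assms(2)
    by (auto simp: a_def b_def)
  \<comment> \<open>This is the pair with \<open>l = 1\<close>, where the onset of \<open>a\<close>
    is \<open>a 1\<close>.\<close>
  have C1: "indicator (group_event M D [(C, 1, k-1), (AT, k, k)]) \<omega> =
      (of_bool (onset b k \<and> a 1) :: real)"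
    using ba[of 1] assms(1,2)
    by (auto simp: group_event_def indicator_def a_def b_def onset_def)
  have less_k: "l < k" if "l \<in> {2..k-1}" for l using that assms(1) by auto
  have Fl: "indicator (group_event M D [(NT, 1, l-1), (F, l, k-1), (AT, k, k)]) \<omega> =
      (of_bool (onset a k \<and> onset b l) :: real)" if "l \<in> {2..k-1}" for l
    unfolding group_event_def indicator_def using ab[of l] assms(1,2) that less_k[OF that]
    by (auto simp: a_def b_def)
  have Cl: "indicator (group_event M D [(NT, 1, l-1), (C, l, k-1), (AT, k, k)]) \<omega> =
      (of_bool (onset b k \<and> onset a l) :: real)" if "l \<in> {2..k-1}" for l
    unfolding group_event_def indicator_def using ba[of l] assms(1,2) that less_k[OF that]
    by (auto simp: a_def b_def)
  have Fs: "(\<Sum>l=2..k-1. indicator (group_event M D [(NT, 1, l-1), (F, l, k-1), (AT, k, k)]) \<omega>) =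
      (\<Sum>l=2..k-1. of_bool (onset a k \<and> onset b l) :: real)"
    by (intro sum.cong refl Fl)
  have Cs: "(\<Sum>l=2..k-1. indicator (group_event M D [(NT, 1, l-1), (C, l, k-1), (AT, k, k)]) \<omega>) =
      (\<Sum>l=2..k-1. of_bool (onset b k \<and> onset a l) :: real)"
    by (intro sum.cong refl Cl)
  \<comment> \<open>Onset of \<open>a\<close> at \<open>k \<ge> 2\<close> together with
    \<open>b 1\<close> would make the unit a defier in period 1. The mirrored term survives: it is
    the group that is \<open>C\<close> up to \<open>k - 1\<close> and \<open>AT\<close> at
    \<open>k\<close>.\<close>
  have null: "(of_bool (onset a k \<and> b 1) :: real) = 0"
    using F1 assms(1) by (auto simp: onset_def a_def b_def)
  have "(of_bool (onset a k) :: real) - of_bool (onset b k) =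
    (\<Sum>g\<in>groups_plus k. indicator (group_event M D g) \<omega>) -
    (\<Sum>g\<in>groups_minus k. indicator (group_event M D g) \<omega>)"
    unfolding sum_groups_plus sum_groups_minus C F C1 Fs Cs
      onset_split[OF assms(1), of a b] onset_split[OF assms(1), of b a] null
    by (simp add: conj_commute[of "onset b k" "onset a k"] del: sum_of_bool_eq)
  then show ?thesis by (simp add: a_def b_def)
qed

section \<open>Measurability and integrability of group events and onsets\<close>

lemma sets_group_event:
  assumes "\<And>t z. t \<in> {1..T} \<Longrightarrow> D t z \<in> measurable M (count_space UNIV)"
    and "\<forall>(a, s, s') \<in> set g. 1 \<le> s \<and> s' \<le> T"
  shows "group_event M D g \<in> sets M"
proof -
  have type: "{\<omega> \<in> space M. has_type D a r \<omega>} \<in> sets M" if "r \<in> {1..T}" for a r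
  proof -
    note [measurable] = assms(1)[OF that]
    show ?thesis by (cases a) simp_all
  qed
  have entry: "{\<omega> \<in> space M. \<forall>r\<in>{s..s'}. has_type D a r \<omega>} \<in> sets M" if "(a, s, s') \<in> set g" for a s s'
    using assms(2) that by (intro sets.sets_Collect_finite_All type) force+
  have "{\<omega> \<in> space M. \<forall>e \<in> set g. \<omega> \<in> {\<omega> \<in> space M. \<forall>r\<in>{fst (snd e)..snd (snd e)}. has_type D (fst e) r \<omega>}} \<in> sets M"
    by (intro sets.sets_Collect_finite_All) (auto intro!: entry)
  also have "{\<omega> \<in> space M. \<forall>e \<in> set g. \<omega> \<in> {\<omega> \<in> space M. \<forall>r\<in>{fst (snd e)..snd (snd e)}. has_type D (fst e) r \<omega>}}
      = group_event M D g"
    by (auto simp: group_event_def split_beta)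
  finally show ?thesis .
qed

lemma sets_group_event_groups:
  assumes "\<And>t z. t \<in> {1..T} \<Longrightarrow> D t z \<in> measurable M (count_space UNIV)"
    and "2 \<le> k" "k \<le> T" "g \<in> groups_plus k \<union> groups_minus k"
  shows "group_event M D g \<in> sets M"
  by (rule sets_group_event[OF assms(1)])
     (use assms(2-4) in \<open>auto simp: groups_plus_def groups_minus_def\<close>)

lemma pred_onset:
  assumes "\<And>s. s \<in> {1..k} \<Longrightarrow> d s \<in> measurable M (count_space UNIV)" and "1 \<le> k"
  shows "Measurable.pred M (\<lambda>\<omega>. onset (\<lambda>s. d s \<omega>) k)"
  unfolding onset_def using assms by (intro pred_intros_logic pred_intros_finite) auto

lemma integrable_onset_mult:
  fixes W :: "'a \<Rightarrow> real"
  assumes "\<And>s. s \<in> {1..k} \<Longrightarrow> d s \<in> measurable M (count_space UNIV)" "1 \<le> k"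
    and "integrable M W"
  shows "integrable M (\<lambda>\<omega>. of_bool (onset (\<lambda>s. d s \<omega>) k) * W \<omega>)"
proof -
  have "{\<omega> \<in> space M. onset (\<lambda>s. d s \<omega>) k} \<in> sets M"
    using pred_onset[of k d M] assms by simp
  from integrable_mult_indicator[OF this assms(3)] show ?thesis
    by (rule Bochner_Integration.integrable_cong[THEN iffD1, rotated 2]) auto
qed

text \<open>The probability cancels the denominator of the conditional expectation. For a null group
  the left side has a zero factor and the integrand on the right vanishes almost everywhere, in line
  with reading such a product as 0.\<close>

lemma group_prob_mult_expectation_given:
  fixes X :: "'a \<Rightarrow> real"
  assumes "finite_measure M" "group_event M D g \<in> sets M"
  shows "group_prob M D g * expectation_given M X (group_event M D g) =
    (LINT \<omega>|M. indicator (group_event M D g) \<omega> * X \<omega>)"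
proof (cases "measure M (group_event M D g) = 0")
  case True
  then have "AE \<omega> in M. \<omega> \<notin> group_event M D g"
    using assms finite_measure.emeasure_eq_measure[OF assms(1)]
    by (intro AE_not_in) (auto simp: null_sets_def)
  then have "(LINT \<omega>|M. indicator (group_event M D g) \<omega> * X \<omega>) = 0"
    by (intro integral_eq_zero_AE) (auto simp: indicator_def)
  then show ?thesis using True by (simp add: group_prob_def)
next
  case False
  then show ?thesis
    by (simp add: group_prob_def expectation_given_def set_lebesgue_integral_def)
qed

section \<open>Expected onset difference between the two instrument values\<close>

text \<open>Common core of both formulas: the pointwise group decomposition is integrated against
  weights \<open>W k\<close>. The reduced form takes the effect of onset at \<open>k\<close> as
  weight, the first stage takes 1.\<close>

lemma expectation_onset_diff:
  fixes W :: "nat \<Rightarrow> 'a \<Rightarrow> real"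
  assumes D: "\<And>t z. t \<in> {1..T} \<Longrightarrow> D t z \<in> measurable M (count_space UNIV)"
    and t: "1 \<le> t" "t \<le> T"
    and W: "\<And>k. k \<in> {1..t} \<Longrightarrow> integrable M (W k)"
    and irr: "AE \<omega> in M. \<forall>s\<in>{1..<t}. \<forall>z. D s z \<omega> \<longrightarrow> D (Suc s) z \<omega>"
    and F1: "AE \<omega> in M. \<not> has_type D F 1 \<omega>"
  shows "(LINT \<omega>|M. (\<Sum>k=1..t. of_bool (onset (\<lambda>s. D s True \<omega>) k) * W k \<omega>)) -
      (LINT \<omega>|M. (\<Sum>k=1..t. of_bool (onset (\<lambda>s. D s False \<omega>) k) * W k \<omega>)) =
    (LINT \<omega>|M. indicator (group_event M D [(C, 1, 1)]) \<omega> * W 1 \<omega>)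
    - (\<Sum>k=2..t. \<Sum>g\<in>groups_minus k. LINT \<omega>|M. indicator (group_event M D g) \<omega> * W k \<omega>)
    + (\<Sum>k=2..t. \<Sum>g\<in>groups_plus k. LINT \<omega>|M. indicator (group_event M D g) \<omega> * W k \<omega>)"
proof -
  have ind: "integrable M (\<lambda>\<omega>. indicator (group_event M D g) \<omega> * W k \<omega>)"
    if "k \<in> {1..t}" "group_event M D g \<in> sets M" for k g
    using integrable_mult_indicator[OF that(2) W[OF that(1)]] by simp
  have ev: "group_event M D g \<in> sets M" if "k \<in> {2..t}" "g \<in> groups_plus k \<union> groups_minus k" for k g
    using sets_group_event_groups[where k = k and g = g, OF D] that t by auto
  have evC: "group_event M D [(C, 1, 1)] \<in> sets M"
    by (rule sets_group_event[OF D]) (use t in auto)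
  have ons: "integrable M (\<lambda>\<omega>. of_bool (onset (\<lambda>s. D s z \<omega>) k) * W k \<omega>)" if "k \<in> {1..t}" for k z
    using that t by (intro integrable_onset_mult D W) auto
  define R where "R = (\<lambda>\<omega>. indicator (group_event M D [(C, 1, 1)]) \<omega> * W 1 \<omega>
    - (\<Sum>k=2..t. \<Sum>g\<in>groups_minus k. indicator (group_event M D g) \<omega> * W k \<omega>)
    + (\<Sum>k=2..t. \<Sum>g\<in>groups_plus k. indicator (group_event M D g) \<omega> * W k \<omega>))"
  have eq: "AE \<omega> in M. (\<Sum>k=1..t. of_bool (onset (\<lambda>s. D s True \<omega>) k) * W k \<omega>) -
      (\<Sum>k=1..t. of_bool (onset (\<lambda>s. D s False \<omega>) k) * W k \<omega>) = R \<omega>"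
    using irr F1 AE_space
  proof eventually_elim
    case (elim \<omega>)
    define \<delta> :: "nat \<Rightarrow> real" where
      "\<delta> k = of_bool (onset (\<lambda>s. D s True \<omega>) k) - of_bool (onset (\<lambda>s. D s False \<omega>) k)" for k
    \<comment> \<open>At period 1 onset is treatment itself, so \<open>\<delta> 1\<close> is 1 on
      \<open>C\<close>, -1 on \<open>F\<close> and 0 otherwise; \<open>F\<close> is excluded
      here.\<close>
    have 1: "\<delta> 1 = indicator (group_event M D [(C, 1, 1)]) \<omega>"
      using elim by (auto simp: \<delta>_def group_event_def onset_def indicator_def)
    have k: "\<delta> k = (\<Sum>g\<in>groups_plus k. indicator (group_event M D g) \<omega>) -
        (\<Sum>g\<in>groups_minus k. indicator (group_event M D g) \<omega>)" if "k \<in> {2..t}" for k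
      unfolding \<delta>_def using that elim by (intro onset_diff_eq_groups) auto
    have "(\<Sum>k=1..t. of_bool (onset (\<lambda>s. D s True \<omega>) k) * W k \<omega>) -
        (\<Sum>k=1..t. of_bool (onset (\<lambda>s. D s False \<omega>) k) * W k \<omega>) = (\<Sum>k=1..t. \<delta> k * W k \<omega>)"
      unfolding \<delta>_def left_diff_distrib sum_subtractf ..
    also have "\<dots> = \<delta> 1 * W 1 \<omega> + (\<Sum>k=2..t. \<delta> k * W k \<omega>)"
      using t by (simp add: sum.atLeast_Suc_atMost numeral_2_eq_2)
    also have "\<dots> = R \<omega>"
      unfolding R_def 1
      by (simp add: k left_diff_distrib sum_subtractf sum_distrib_right)
    finally show ?case .
  qed
  have "(LINT \<omega>|M. (\<Sum>k=1..t. of_bool (onset (\<lambda>s. D s True \<omega>) k) * W k \<omega>)) -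
      (LINT \<omega>|M. (\<Sum>k=1..t. of_bool (onset (\<lambda>s. D s False \<omega>) k) * W k \<omega>)) =
    (LINT \<omega>|M. (\<Sum>k=1..t. of_bool (onset (\<lambda>s. D s True \<omega>) k) * W k \<omega>) -
      (\<Sum>k=1..t. of_bool (onset (\<lambda>s. D s False \<omega>) k) * W k \<omega>))"
    by (intro Bochner_Integration.integral_diff[symmetric] Bochner_Integration.integrable_sum ons) auto
  also have "\<dots> = integral\<^sup>L M R"
  proof (rule integral_cong_AE[OF _ _ eq])
    show "(\<lambda>\<omega>. (\<Sum>k=1..t. of_bool (onset (\<lambda>s. D s True \<omega>) k) * W k \<omega>) -
      (\<Sum>k=1..t. of_bool (onset (\<lambda>s. D s False \<omega>) k) * W k \<omega>)) \<in> borel_measurable M"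
      by (intro borel_measurable_diff borel_measurable_sum borel_measurable_integrable[OF ons]) auto
    show "R \<in> borel_measurable M"
      unfolding R_def
      by (intro borel_measurable_add borel_measurable_diff borel_measurable_sum
          borel_measurable_integrable[OF ind] ev evC) (use t in auto)
  qed
  also have "\<dots> = (LINT \<omega>|M. indicator (group_event M D [(C, 1, 1)]) \<omega> * W 1 \<omega>)
    - (\<Sum>k=2..t. \<Sum>g\<in>groups_minus k. LINT \<omega>|M. indicator (group_event M D g) \<omega> * W k \<omega>)
    + (\<Sum>k=2..t. \<Sum>g\<in>groups_plus k. LINT \<omega>|M. indicator (group_event M D g) \<omega> * W k \<omega>)"
  proof -
    define I where "I g k \<omega> = indicator (group_event M D g) \<omega> * W k \<omega>" for g k \<omega>
    have c: "integrable M (I [(C, 1, 1)] 1)"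
      unfolding I_def using t by (intro ind evC) auto
    have m: "integrable M (I g k)" if "k \<in> {2..t}" "g \<in> groups_minus k" for k g
      unfolding I_def using that by (intro ind ev[of k]) auto
    have p: "integrable M (I g k)" if "k \<in> {2..t}" "g \<in> groups_plus k" for k g
      unfolding I_def using that by (intro ind ev[of k]) auto
    have "integrable M (\<lambda>\<omega>. \<Sum>k=2..t. \<Sum>g\<in>groups_minus k. I g k \<omega>)"
      and "integrable M (\<lambda>\<omega>. \<Sum>k=2..t. \<Sum>g\<in>groups_plus k. I g k \<omega>)"
      by (intro Bochner_Integration.integrable_sum m p; assumption)+
    \<comment> \<open>A general family \<open>G\<close> lets one interchange of sum and integral
      serve both signs.\<close>
    moreover have "(LINT \<omega>|M. (\<Sum>k=2..t. \<Sum>g\<in>G k. I g k \<omega>)) =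
        (\<Sum>k=2..t. \<Sum>g\<in>G k. integral\<^sup>L M (I g k))"
      if G: "\<And>k g. k \<in> {2..t} \<Longrightarrow> g \<in> G k \<Longrightarrow> integrable M (I g k)" for G
    proof -
      have "(LINT \<omega>|M. (\<Sum>k=2..t. \<Sum>g\<in>G k. I g k \<omega>)) =
          (\<Sum>k=2..t. LINT \<omega>|M. (\<Sum>g\<in>G k. I g k \<omega>))"
        by (intro Bochner_Integration.integral_sum Bochner_Integration.integrable_sum G)
      also have "\<dots> = (\<Sum>k=2..t. \<Sum>g\<in>G k. integral\<^sup>L M (I g k))"
        by (intro sum.cong refl Bochner_Integration.integral_sum G)
      finally show ?thesis .
    qed
    note this[of groups_minus, OF m] this[of groups_plus, OF p]
    ultimately show ?thesis
      unfolding R_def I_def[symmetric] using c by simp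
  qed
  finally show ?thesis .
qed

section \<open>Independence and outcomes along a path\<close>

text \<open>The \<sigma>-algebras generated by \<open>f\<close> and by the indicator of
  \<open>b\<close> lie inside \<open>A\<close> and \<open>B\<close>, so the two functions are
  independent and the expectation of their product factorises.\<close>

lemma (in prob_space) set_integral_indep_set:
  fixes f :: "'a \<Rightarrow> real"
  assumes indep: "indep_set (sets A) (sets B)"
    and A: "space A = space M" and B: "space B = space M"
    and f: "f \<in> borel_measurable A" "integrable M f" and b: "b \<in> sets B"
  shows "(LINT \<omega>:b|M. f \<omega>) = prob b * expectation f"
proof -
  have sub: "sets A \<subseteq> events" "sets B \<subseteq> events"
    using indep unfolding indep_set_def indep_sets_def by (auto split: bool.splits)
  have b': "b \<in> events" using b sub by auto
  have "indep_var borel f borel (indicator b :: 'a \<Rightarrow> real)"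
  proof (subst indep_var_eq, intro conjI)
    show "random_variable borel f" using f(2) by simp
    show "random_variable borel (indicator b :: 'a \<Rightarrow> real)" using b' by simp
    have 1: "sigma_sets (space M) {f -` S \<inter> space M |S. S \<in> sets borel} \<subseteq> sets A"
      unfolding A[symmetric] using measurable_sets[OF f(1)]
      by (intro sets.sigma_sets_subset) auto
    have "(indicator b :: 'a \<Rightarrow> real) \<in> borel_measurable B" using b by simp
    then have 2: "sigma_sets (space M) {(indicator b :: 'a \<Rightarrow> real) -` S \<inter> space M |S. S \<in> sets borel} \<subseteq> sets B"
      unfolding B[symmetric] using measurable_sets[of "indicator b :: 'a \<Rightarrow> real" B borel]
      by (intro sets.sigma_sets_subset) auto
    show "indep_set (sigma_sets (space M) {f -` S \<inter> space M |S. S \<in> sets borel})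
       (sigma_sets (space M) {(indicator b :: 'a \<Rightarrow> real) -` S \<inter> space M |S. S \<in> sets borel})"
      using indep 1 2 unfolding indep_set_def
      by (elim indep_sets_mono_sets) (auto split: bool.splits)
  qed
  moreover have "integrable M (indicator b :: 'a \<Rightarrow> real)"
    using b' by (simp add: emeasure_eq_measure)
  ultimately have "expectation (\<lambda>\<omega>. f \<omega> * indicator b \<omega>) = expectation f * prob b"
    using indep_var_lebesgue_integral[of f "indicator b"] f(2) b' by simp
  then show ?thesis by (simp add: set_lebesgue_integral_def mult.commute)
qed

text \<open>The outcome at \<open>t\<close> along the path \<open>d\<close>: onset at
  \<open>k\<close> means exposure \<open>t - k\<close>, and \<open>y0\<close> then cancels. With
  \<open>y0\<close> and \<open>y1\<close> as parameters it covers outcomes both before and after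
  exclusion.\<close>

definition onset_outcome ::
  "nat \<Rightarrow> (nat \<Rightarrow> 'a \<Rightarrow> bool) \<Rightarrow> ('a \<Rightarrow> real) \<Rightarrow> (nat \<Rightarrow> 'a \<Rightarrow> real) \<Rightarrow> 'a \<Rightarrow> real" where
  "onset_outcome t d y0 y1 \<omega> =
    y0 \<omega> + (\<Sum>k=1..t. of_bool (onset (\<lambda>s. d s \<omega>) k) * (y1 (t - k) \<omega> - y0 \<omega>))"

lemma observed_Y_eq_onset_outcome:
  assumes "Z \<omega> = z"
  shows "observed_Y Z D Y0z Y1z t \<omega> =
    onset_outcome t (\<lambda>s. D s z) (Y0z t z) (\<lambda>\<tau>. Y1z t \<tau> z) \<omega>"
  unfolding onset_outcome_def sum_onset observed_Y_def first_treated_def observed_D_def assms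
  by auto

text \<open>Serves both for the full space and for the \<sigma>-algebra generated by the potential
  quantities.\<close>

lemma borel_measurable_onset_outcome:
  assumes "\<And>s. s \<in> {1..t} \<Longrightarrow> d s \<in> measurable M (count_space UNIV)"
    and "y0 \<in> borel_measurable M"
    and "\<And>\<tau>. \<tau> < t \<Longrightarrow> y1 \<tau> \<in> borel_measurable M"
  shows "onset_outcome t d y0 y1 \<in> borel_measurable M"
proof -
  have "(\<lambda>\<omega>. of_bool (onset (\<lambda>s. d s \<omega>) k) :: real) \<in> borel_measurable M" if "k \<in> {1..t}" for k
  proof -
    have [measurable]: "Measurable.pred M (\<lambda>\<omega>. onset (\<lambda>s. d s \<omega>) k)"
      using that by (intro pred_onset assms(1)) auto
    show ?thesis by measurable
  qed
  then show ?thesis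
    unfolding onset_outcome_def
    using assms(2,3) by (intro borel_measurable_add borel_measurable_sum borel_measurable_times borel_measurable_diff) auto
qed

section \<open>Decomposition of the reduced form and the first stage\<close>

theorem proposition3p1:
  fixes M :: "'a measure" and T :: nat
    and Z :: "'a \<Rightarrow> bool" and D :: "nat \<Rightarrow> bool \<Rightarrow> 'a \<Rightarrow> bool"
    and Y0z :: "nat \<Rightarrow> bool \<Rightarrow> 'a \<Rightarrow> real" and Y1z :: "nat \<Rightarrow> nat \<Rightarrow> bool \<Rightarrow> 'a \<Rightarrow> real"
    and Y0 :: "nat \<Rightarrow> 'a \<Rightarrow> real" and Y1 :: "nat \<Rightarrow> nat \<Rightarrow> 'a \<Rightarrow> real"
  assumes "prob_space M"
    and "Z \<in> measurable M (count_space UNIV)"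
    and "0 < \<P>(\<omega> in M. Z \<omega>)" and "\<P>(\<omega> in M. Z \<omega>) < 1"
    and "\<And>t z. t \<in> {1..T} \<Longrightarrow> D t z \<in> measurable M (count_space UNIV)"
    and "\<And>t z. t \<in> {1..T} \<Longrightarrow> integrable M (Y0z t z)"
    and "\<And>t \<tau> z. t \<in> {1..T} \<Longrightarrow> \<tau> \<in> {0..t - 1} \<Longrightarrow> integrable M (Y1z t \<tau> z)"
    and irreversible: "irreversible_treatment M T Z D"
    and exclusion: "exclusion M T Y0z Y1z Y0 Y1"
    and independence: "independence M T Z D Y0 Y1"
    and relevance: "FS M Z D 1 \<noteq> 0"
    and monotonicity: "group_prob M D [(F, 1, 1)] = 0"
  shows "\<forall>t \<in> {1..T} - {1}.
    RF M Z D Y0z Y1z t =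
      group_prob M D [(C, 1, 1)] * causal_effect M D Y0 Y1 t (t - 1) [(C, 1, 1)]
      - (\<Sum>k=2..t. \<Sum>g\<in>groups_minus k. group_prob M D g * causal_effect M D Y0 Y1 t (t - k) g)
      + (\<Sum>k=2..t. \<Sum>g\<in>groups_plus k. group_prob M D g * causal_effect M D Y0 Y1 t (t - k) g)
    \<and>
    FS M Z D t =
      group_prob M D [(C, 1, 1)]
      - (\<Sum>k=2..t. \<Sum>g\<in>groups_minus k. group_prob M D g)
      + (\<Sum>k=2..t. \<Sum>g\<in>groups_plus k. group_prob M D g)"
proof
  interpret prob_space M by fact
  fix t assume t': "t \<in> {1..T} - {1}"
  then have t: "2 \<le> t" "t \<le> T" "1 \<le> t" "t \<in> {1..T}" by auto
  note Z = assms(2) and Z1 = assms(3) and Z0 = assms(4) and D = assms(5)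
    and intY0z = assms(6) and intY1z = assms(7)
  \<comment> \<open>\<open>V u\<close> is the vector in the independence assumption,
    \<open>N u\<close> its value space, and \<open>A u\<close> and \<open>B\<close> are the
    \<sigma>-algebras generated by it and by the instrument. Whatever is measurable over
    \<open>A u\<close> can then be separated from \<open>Z\<close>.\<close>
  define V where "V u = (\<lambda>\<omega>. (Y0 u \<omega>, \<lambda>\<tau>\<in>{0..u - 1}. Y1 u \<tau> \<omega>,
                 \<lambda>(s, z)\<in>{1..u} \<times> UNIV. D s z \<omega>))" for u
  define N :: "nat \<Rightarrow> (real \<times> (nat \<Rightarrow> real) \<times> (nat \<times> bool \<Rightarrow> bool)) measure" where
    "N u = borel \<Otimes>\<^sub>M (\<Pi>\<^sub>M \<tau>\<in>{0..u - 1}. borel) \<Otimes>\<^sub>M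
           (\<Pi>\<^sub>M (s, z)\<in>{1..u} \<times> UNIV. count_space UNIV)" for u
  define A where "A u = vimage_algebra (space M) (V u) (N u)" for u
  define B where "B = vimage_algebra (space M) Z (count_space UNIV)"
  have indep: "indep_set (sets (A u)) (sets B)" if "u \<in> {1..T}" for u
    using independence that unfolding independence_def A_def B_def V_def N_def by auto
  have space_A [simp]: "space (A u) = space M" and space_B [simp]: "space B = space M" for u
    by (simp_all add: A_def B_def)
  have A_sub: "sets (A u) \<subseteq> events" if "u \<in> {1..T}" for u
    using indep[OF that] unfolding indep_set_def indep_sets_def by (auto split: bool.splits)
  have V: "V u \<in> measurable (A u) (N u)" for u
    unfolding A_def
    by (rule measurable_vimage_algebra1) (auto simp: V_def N_def space_pair_measure space_PiM)
  have A_Y0: "Y0 u \<in> borel_measurable (A u)" for u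
    using measurable_compose[OF V[unfolded N_def] measurable_fst] by (simp add: V_def)
  have A_Y1: "Y1 u \<tau> \<in> borel_measurable (A u)" if "\<tau> \<in> {0..u - 1}" for u \<tau>
    using measurable_compose[OF measurable_compose[OF measurable_compose[OF V[of u, unfolded N_def]
        measurable_snd] measurable_fst] measurable_component_singleton[OF that]] that
    by (simp add: V_def)
  have A_D: "D s z \<in> measurable (A u) (count_space UNIV)" if "s \<in> {1..u}" for u s z
    using measurable_compose[OF measurable_compose[OF measurable_compose[OF V[of u, unfolded N_def]
        measurable_snd] measurable_snd] measurable_component_singleton[of "(s, z)"]] that
    by (simp add: V_def)
  \<comment> \<open>Independence already places the generated \<sigma>-algebra among the events,
    which yields measurability over \<open>M\<close>.\<close>
  have Y0_meas: "Y0 t \<in> borel_measurable M"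
    using A_Y0[of t] A_sub[OF t(4)] by (auto simp: measurable_def)
  have Y1_meas: "Y1 t \<tau> \<in> borel_measurable M" if "\<tau> \<in> {0..t - 1}" for \<tau>
    using A_Y1[OF that] A_sub[OF t(4)] by (auto simp: measurable_def)
  have Y0_eq: "AE \<omega> in M. Y0z t z \<omega> = Y0 t \<omega>" for z
    using exclusion t by (auto simp: exclusion_def)
  have Y1_eq: "AE \<omega> in M. Y1z t \<tau> z \<omega> = Y1 t \<tau> \<omega>" if "\<tau> \<in> {0..t - 1}" for \<tau> z
    using exclusion t that unfolding exclusion_def by blast
  \<comment> \<open>Integrability passes from the instrument-dependent outcomes through almost sure
    equality under exclusion.\<close>
  have Y0_int: "integrable M (Y0 t)"
    using integrable_cong_AE_imp[OF intY0z[OF t(4), of True] Y0_meas] Y0_eq[of True]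
    by (auto simp: eq_commute)
  have Y1_int: "integrable M (Y1 t \<tau>)" if "\<tau> \<in> {0..t - 1}" for \<tau>
    using integrable_cong_AE_imp[OF intY1z[OF t(4) that, of True] Y1_meas[OF that]] Y1_eq[OF that, of True]
    by (auto simp: eq_commute)

  define zev where "zev z = {\<omega> \<in> space M. Z \<omega> = z}" for z
  have zev_B: "zev z \<in> sets B" for z
    unfolding B_def zev_def
    by (subst sets_vimage_algebra) (auto intro!: exI[of _ "{z}"])
  have zev_M: "zev z \<in> events" for z
    using Z unfolding zev_def by measurable
  have "zev False = space M - zev True" by (auto simp: zev_def)
  then have "prob (zev False) = 1 - prob (zev True)"
    using prob_compl[OF zev_M[of True]] by simp
  then have prob_zev: "prob (zev z) > 0" for z
    using Z1 Z0 by (cases z) (auto simp: zev_def)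
  \<comment> \<open>On the arm \<open>Z = z\<close> the observed \<open>X\<close> may be replaced by
    an \<open>f\<close> determined by the independent vector. Independence then removes the
    conditioning, and positivity of the arm's probability permits the division.\<close>
  have cond: "expectation_given M X (zev z) = expectation f"
    if "f \<in> borel_measurable (A t)" "integrable M f" and "X \<in> borel_measurable M"
      and "AE \<omega> in M. \<omega> \<in> zev z \<longrightarrow> X \<omega> = f \<omega>" for X f z
  proof -
    have "(LINT \<omega>:zev z|M. X \<omega>) = (LINT \<omega>:zev z|M. f \<omega>)"
      using that zev_M by (intro set_lebesgue_integral_cong_AE) auto
    also have "\<dots> = prob (zev z) * expectation f"
      by (rule set_integral_indep_set[OF indep[OF t(4)] _ _ that(1,2) zev_B]) simp_all
    finally show ?thesis
      using prob_zev[of z] by (simp add: expectation_given_def)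
  qed

  \<comment> \<open>Irreversibility is assumed for the observed path only. The event
    \<open>b\<close> that the potential path reverts after \<open>s\<close> depends on the vector up
    to \<open>Suc s\<close>, so it is independent of \<open>Z\<close>. On \<open>Z = z\<close> this
    path is observed, hence \<open>b\<close> is null there; since the arm has positive probability,
    \<open>b\<close> itself is null.\<close>
  have irr1: "AE \<omega> in M. D s z \<omega> \<longrightarrow> D (Suc s) z \<omega>" if s: "s \<in> {1..<T}" for s z
  proof -
    define b where "b = {\<omega> \<in> space M. D s z \<omega> \<and> \<not> D (Suc s) z \<omega>}"
    have [measurable]: "D s z \<in> measurable (A (Suc s)) (count_space UNIV)"
      "D (Suc s) z \<in> measurable (A (Suc s)) (count_space UNIV)"
      using s by (auto intro!: A_D)
    have "{\<omega> \<in> space (A (Suc s)). D s z \<omega> \<and> \<not> D (Suc s) z \<omega>} \<in> sets (A (Suc s))"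
      by measurable
    then have b: "b \<in> sets (A (Suc s))" by (simp add: b_def)
    have u: "Suc s \<in> {1..T}" using s by auto
    have b': "b \<in> events" using b A_sub[OF u] by auto
    have "AE \<omega> in M. observed_D Z D s \<omega> \<longrightarrow> observed_D Z D (s + 1) \<omega>"
      using irreversible s unfolding irreversible_treatment_def by auto
    then have "AE \<omega> in M. \<omega> \<notin> b \<inter> zev z"
      by eventually_elim (cases z; auto simp: b_def zev_def observed_D_def)
    then have "prob (b \<inter> zev z) = 0"
      using b' zev_M by (subst prob_eq_0) auto
    moreover have "prob (b \<inter> zev z) = prob b * prob (zev z)"
      using indep_setD[OF indep[OF u] b zev_B] .
    ultimately have "prob b = 0" using prob_zev[of z] by auto
    then have "AE \<omega> in M. \<omega> \<notin> b" using b' prob_eq_0 by blast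
    then show ?thesis using AE_space by eventually_elim (auto simp: b_def)
  qed
  have irr: "AE \<omega> in M. \<forall>s\<in>{1..<t}. \<forall>z. D s z \<omega> \<longrightarrow> D (Suc s) z \<omega>"
  proof -
    have "AE \<omega> in M. \<forall>z. D s z \<omega> \<longrightarrow> D (Suc s) z \<omega>" if "s \<in> {1..<t}" for s
      using that t by (subst AE_all_countable) (auto intro!: irr1)
    then show ?thesis by (intro AE_finite_allI) auto
  qed
  have F1: "AE \<omega> in M. \<not> has_type D F 1 \<omega>"
  proof -
    have "group_event M D [(F, 1, 1)] \<in> events"
      using t by (intro sets_group_event[OF D]) auto
    then have "AE \<omega> in M. \<omega> \<notin> group_event M D [(F, 1, 1)]"
      using monotonicity prob_eq_0 unfolding group_prob_def by blast
    then show ?thesis using AE_space by eventually_elim (auto simp: group_event_def)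
  qed
  have ev: "group_event M D g \<in> events" if "k \<in> {2..t}" "g \<in> groups_plus k \<union> groups_minus k" for k g
    using sets_group_event_groups[where k = k and g = g, OF D] that t by auto
  have evC: "group_event M D [(C, 1, 1)] \<in> events"
    using t by (intro sets_group_event[OF D]) auto

  define W where "W k \<omega> = Y1 t (t - k) \<omega> - Y0 t \<omega>" for k \<omega>
  have W_int: "integrable M (W k)" if "k \<in> {1..t}" for k
    unfolding W_def using that by (intro Bochner_Integration.integrable_diff Y0_int Y1_int) auto
  have onset_int: "integrable M (\<lambda>\<omega>. of_bool (onset (\<lambda>s. D s z \<omega>) k) * X \<omega>)"
    if "k \<in> {1..t}" "integrable M X" for k z and X :: "'a \<Rightarrow> real"
    using that t by (intro integrable_onset_mult D) auto
  \<comment> \<open>The leading term is the same for both \<open>z\<close> and cancels in the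
    reduced form.\<close>
  have exp_Y: "expectation_given M (observed_Y Z D Y0z Y1z t) (zev z) =
      expectation (Y0 t) + (LINT \<omega>|M. (\<Sum>k=1..t. of_bool (onset (\<lambda>s. D s z \<omega>) k) * W k \<omega>))" for z
  proof -
    have "expectation_given M (observed_Y Z D Y0z Y1z t) (zev z) =
        expectation (onset_outcome t (\<lambda>s. D s z) (Y0 t) (Y1 t))"
    proof (rule cond)
      show "onset_outcome t (\<lambda>s. D s z) (Y0 t) (Y1 t) \<in> borel_measurable (A t)"
        using t by (intro borel_measurable_onset_outcome A_Y0 A_Y1 A_D) auto
      show "integrable M (onset_outcome t (\<lambda>s. D s z) (Y0 t) (Y1 t))"
        unfolding onset_outcome_def W_def[symmetric]
        by (intro Bochner_Integration.integrable_add Bochner_Integration.integrable_sum Y0_int onset_int W_int)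
      define P where "P z = onset_outcome t (\<lambda>s. D s z) (Y0z t z) (\<lambda>\<tau>. Y1z t \<tau> z)" for z
      have [measurable]: "P z \<in> borel_measurable M" for z
        unfolding P_def using t
        by (intro borel_measurable_onset_outcome D borel_measurable_integrable[OF intY0z]
            borel_measurable_integrable[OF intY1z]) auto
      \<comment> \<open>Selecting between two measurable path outcomes by \<open>Z\<close> gives
        measurability without handling \<open>first_treated\<close>.\<close>
      have "observed_Y Z D Y0z Y1z t = (\<lambda>\<omega>. if Z \<omega> then P True \<omega> else P False \<omega>)"
        unfolding P_def using observed_Y_eq_onset_outcome[of Z _ _ D Y0z Y1z t] by auto
      moreover note [measurable] = Z
      ultimately show "observed_Y Z D Y0z Y1z t \<in> borel_measurable M" by simp
      have "AE \<omega> in M. \<forall>\<tau>\<in>{0..t - 1}. Y1z t \<tau> z \<omega> = Y1 t \<tau> \<omega>"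
        by (intro AE_finite_allI Y1_eq) auto
      with Y0_eq[of z] show "AE \<omega> in M. \<omega> \<in> zev z \<longrightarrow>
          observed_Y Z D Y0z Y1z t \<omega> = onset_outcome t (\<lambda>s. D s z) (Y0 t) (Y1 t) \<omega>"
      proof eventually_elim
        case (elim \<omega>)
        \<comment> \<open>For \<open>k\<close> in \<open>{1..t}\<close> the exposure
          \<open>t - k\<close> stays in \<open>{0..t - 1}\<close>, where exclusion applies.\<close>
        have "(\<Sum>k=1..t. of_bool (onset (\<lambda>s. D s z \<omega>) k) * (Y1z t (t - k) z \<omega> - Y0z t z \<omega>)) =
            (\<Sum>k=1..t. of_bool (onset (\<lambda>s. D s z \<omega>) k) * (Y1 t (t - k) \<omega> - Y0 t \<omega>))"
          by (intro sum.cong refl) (use elim in auto)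
        then show ?case
          using elim observed_Y_eq_onset_outcome[of Z \<omega> z D Y0z Y1z t]
          by (auto simp: onset_outcome_def zev_def)
      qed
    qed
    also have "\<dots> = expectation (Y0 t) + (LINT \<omega>|M. (\<Sum>k=1..t. of_bool (onset (\<lambda>s. D s z \<omega>) k) * W k \<omega>))"
      unfolding onset_outcome_def W_def[symmetric]
      by (intro Bochner_Integration.integral_add Bochner_Integration.integrable_sum Y0_int onset_int W_int)
    finally show ?thesis .
  qed
  \<comment> \<open>The factor 1 keeps the shape of \<open>expectation_onset_diff\<close> with unit
    weights.\<close>
  have exp_D: "expectation_given M (\<lambda>\<omega>. of_bool (observed_D Z D t \<omega>)) (zev z) =
      (LINT \<omega>|M. (\<Sum>k=1..t. of_bool (onset (\<lambda>s. D s z \<omega>) k) * 1))" for z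
  proof (rule cond)
    show "(\<lambda>\<omega>. \<Sum>k=1..t. of_bool (onset (\<lambda>s. D s z \<omega>) k) * 1 :: real) \<in> borel_measurable (A t)"
      \<comment> \<open>The sum is an onset outcome with untreated value 0 and treated value
        1.\<close>
      using borel_measurable_onset_outcome[of t "\<lambda>s. D s z" "A t" "\<lambda>_. 0" "\<lambda>_ _. 1"] A_D[of _ t z]
      by (simp add: onset_outcome_def[abs_def] del: sum_of_bool_eq sum_of_bool_mult_eq)
    show "integrable M (\<lambda>\<omega>. \<Sum>k=1..t. of_bool (onset (\<lambda>s. D s z \<omega>) k) * 1 :: real)"
      by (intro Bochner_Integration.integrable_sum onset_int) auto
    note [measurable] = Z D[OF t(4)]
    have "(\<lambda>\<omega>. of_bool (observed_D Z D t \<omega>) :: real) =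
        (\<lambda>\<omega>. if Z \<omega> then of_bool (D t True \<omega>) else of_bool (D t False \<omega>))"
      by (auto simp: observed_D_def)
    then show "(\<lambda>\<omega>. of_bool (observed_D Z D t \<omega>) :: real) \<in> borel_measurable M"
      by simp
    show "AE \<omega> in M. \<omega> \<in> zev z \<longrightarrow> (of_bool (observed_D Z D t \<omega>) :: real) =
        (\<Sum>k=1..t. of_bool (onset (\<lambda>s. D s z \<omega>) k) * 1)"
      using irr
    proof eventually_elim
      case (elim \<omega>)
      then show ?case
        using sum_onset_irreversible[of t "\<lambda>s. D s z \<omega>"] t
        by (auto simp: observed_D_def zev_def simp del: sum_of_bool_eq)
    qed
  qed

  have zev: "{\<omega> \<in> space M. Z \<omega>} = zev True" "{\<omega> \<in> space M. \<not> Z \<omega>} = zev False"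
    by (auto simp: zev_def)
  have contrib: "group_prob M D g * causal_effect M D Y0 Y1 t (t - k) g =
      (LINT \<omega>|M. indicator (group_event M D g) \<omega> * W k \<omega>)" if "group_event M D g \<in> events" for k g
    unfolding causal_effect_def W_def
    by (rule group_prob_mult_expectation_given[OF finite_measure_axioms that])
  have minus: "(\<Sum>k=2..t. \<Sum>g\<in>groups_minus k.
        group_prob M D g * causal_effect M D Y0 Y1 t (t - k) g) =
      (\<Sum>k=2..t. \<Sum>g\<in>groups_minus k. LINT \<omega>|M. indicator (group_event M D g) \<omega> * W k \<omega>)"
    by (intro sum.cong refl contrib, rule ev, assumption, simp)
  have plus: "(\<Sum>k=2..t. \<Sum>g\<in>groups_plus k.
        group_prob M D g * causal_effect M D Y0 Y1 t (t - k) g) =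
      (\<Sum>k=2..t. \<Sum>g\<in>groups_plus k. LINT \<omega>|M. indicator (group_event M D g) \<omega> * W k \<omega>)"
    by (intro sum.cong refl contrib, rule ev, assumption, simp)
  have "RF M Z D Y0z Y1z t =
      group_prob M D [(C, 1, 1)] * causal_effect M D Y0 Y1 t (t - 1) [(C, 1, 1)]
      - (\<Sum>k=2..t. \<Sum>g\<in>groups_minus k. group_prob M D g * causal_effect M D Y0 Y1 t (t - k) g)
      + (\<Sum>k=2..t. \<Sum>g\<in>groups_plus k. group_prob M D g * causal_effect M D Y0 Y1 t (t - k) g)"
    using expectation_onset_diff[where W = W, OF D t(3,2) W_int irr F1]
    unfolding RF_def zev exp_Y minus plus contrib[OF evC] by simp
  \<comment> \<open>Integrating an indicator gives the measure of the event intersected with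
    \<open>space M\<close>.\<close>
  moreover have "group_event M D g \<inter> space M = group_event M D g" for g
    by (auto simp: group_event_def)
  then have "FS M Z D t =
      group_prob M D [(C, 1, 1)]
      - (\<Sum>k=2..t. \<Sum>g\<in>groups_minus k. group_prob M D g)
      + (\<Sum>k=2..t. \<Sum>g\<in>groups_plus k. group_prob M D g)"
    using expectation_onset_diff[OF D t(3,2) _ irr F1, of "\<lambda>_ _. 1"]
    unfolding FS_def zev exp_D group_prob_def
    by (simp del: sum_of_bool_eq)
  ultimately show "RF M Z D Y0z Y1z t =
      group_prob M D [(C, 1, 1)] * causal_effect M D Y0 Y1 t (t - 1) [(C, 1, 1)]
      - (\<Sum>k=2..t. \<Sum>g\<in>groups_minus k. group_prob M D g * causal_effect M D Y0 Y1 t (t - k) g)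
      + (\<Sum>k=2..t. \<Sum>g\<in>groups_plus k. group_prob M D g * causal_effect M D Y0 Y1 t (t - k) g)
    \<and>
    FS M Z D t =
      group_prob M D [(C, 1, 1)]
      - (\<Sum>k=2..t. \<Sum>g\<in>groups_minus k. group_prob M D g)
      + (\<Sum>k=2..t. \<Sum>g\<in>groups_plus k. group_prob M D g)" ..
qed

end
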